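(* Let $S\subseteq\mathbb{N}^p$ be a $\mathcal{C}$-semigroup, let $\preceq$ be a monomial order on $\mathbb{N}^p$, and let $f\in\mathcal{C}$ be greater than or equal to $\mathrm{Fb}(S)$ (with respect to $\preceq$). The following conditions are equivalent: (1) $T$ is an $I(S)$-semigroup with Frobenius element $\mathrm{Fb}(T)=f$. (2) $T=X\sqcup\{x\in\mathcal{C}\mid x\succ f\}\cup\{0\}$, where $X$ is a subset of $A_S(f)$ such that if there exists $x\in X$ with $x+s\prec f$ for some $s\in S$, then $x+s\in X$.
   Context: $\mathbb{N}$ contains $0$, and $p\ge 1$. An affine semigroup of $\mathbb{N}^p$ is a finitely generated submonoid of $(\mathbb{N}^p,+)$ (containing $0$). For $B\subseteq\mathbb{N}^p$, $\mathcal{C}_B=\{\sum_{i=1}^k\lambda_i b_i\mid k\in\mathbb{N},\ \lambda_i\in\mathbb{Q}_{\ge 0},\ b_i\in B\}\cap\mathbb{N}^p$. An affine semigroup $S$ is a $\mathcal{C}$-semigroup, where $\mathcal{C}=\mathcal{C}_S$, if $\mathcal{C}\setminus S$ is finite. A monomial order on $\mathbb{N}^p$ is a total order $\preceq$ compatible with addition and with $0\preceq c$ for all $c\in\mathbb{N}^p$. The Frobenius element of a $\mathcal{C}$-semigroup $S$ is $\mathrm{Fb}(S)=\max_\preceq(\mathcal{C}\setminus S)$. A subset $P$ of $S$ is an ideal of $S$ if $P+S\subseteq P$. An affine semigroup $T$ is an $I(S)$-semigroup if $T\setminus\{0\}$ is an ideal of $S$; it is assumed throughout that any $I(S)$-semigroup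 is a $\mathcal{C}$-semigroup. For $f\in\mathcal{C}$, $A_S(f)=\{x\in S\mid x\prec f\text{ and } f-x\notin S\}$.
   Formalization: It is additionally assumed that C∖T is finite (implied by (1)); without it (2)⇒(1) fails, e.g. lex order on N², S=N²∖{(1,0)}, f=(1,0), X=∅. Also S≠C is assumed, so that Fb(S) exists. *)

theory Defs
  imports "HOL-Analysis.Finite_Cartesian_Product" "HOL.Hull"
begin

definition add_submonoid :: "'a::comm_monoid_add set \<Rightarrow> bool" where
  "add_submonoid M \<longleftrightarrow> 0 \<in> M \<and> (\<forall>x\<in>M. \<forall>y\<in>M. x + y \<in> M)"

definition affine_semigroup :: "(nat ^ 'p) set \<Rightarrow> bool" where
  "affine_semigroup S \<longleftrightarrow> (\<exists>A. finite A \<and> S = add_submonoid hull A)"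

definition rat_cone :: "(nat ^ 'p) set \<Rightarrow> (nat ^ 'p) set" where
  "rat_cone B = {x. \<exists>(k::nat) (l::nat \<Rightarrow> rat) (b::nat \<Rightarrow> nat ^ 'p).
      (\<forall>i<k. 0 \<le> l i \<and> b i \<in> B) \<and>
      (\<forall>j. rat_of_nat (x $ j) = (\<Sum>i<k. l i * rat_of_nat (b i $ j)))}"

definition C_semigroup :: "(nat ^ 'p) set \<Rightarrow> (nat ^ 'p) set \<Rightarrow> bool" where
  "C_semigroup C S \<longleftrightarrow> affine_semigroup S \<and> C = rat_cone S \<and> finite (C - S)"

definition monomial_order :: "(nat ^ 'p \<Rightarrow> nat ^ 'p \<Rightarrow> bool) \<Rightarrow> bool" where
  "monomial_order le \<longleftrightarrow>
     reflp le \<and> transp le \<and> antisymp le \<and> totalp le \<and>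
     (\<forall>a b c. le a b \<longrightarrow> le (a + c) (b + c)) \<and> (\<forall>c. le 0 c)"

definition strict :: "('a \<Rightarrow> 'a \<Rightarrow> bool) \<Rightarrow> 'a \<Rightarrow> 'a \<Rightarrow> bool" where
  "strict le x y \<longleftrightarrow> le x y \<and> x \<noteq> y"

text \<open>The maximum of the set of gaps, as a predicate: it fails for every \<open>f\<close> when
  there are no gaps, that is, when \<open>S\<close> equals its cone.\<close>

definition is_Frobenius ::
  "(nat ^ 'p \<Rightarrow> nat ^ 'p \<Rightarrow> bool) \<Rightarrow> (nat ^ 'p) set \<Rightarrow> nat ^ 'p \<Rightarrow> bool" where
  "is_Frobenius le S f \<longleftrightarrow> f \<in> rat_cone S - S \<and> (\<forall>x \<in> rat_cone S - S. le x f)"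

definition ideal_of :: "(nat ^ 'p) set \<Rightarrow> (nat ^ 'p) set \<Rightarrow> bool" where
  "ideal_of S P \<longleftrightarrow> P \<subseteq> S \<and> (\<forall>x\<in>P. \<forall>s\<in>S. x + s \<in> P)"

text \<open>Being a \<open>C\<close>-semigroup, for the cone \<open>C\<close> of \<open>S\<close>, is part of the notion; it excludes
  \<open>T = {0}\<close> when \<open>S \<noteq> {0}\<close>.\<close>

definition I_semigroup :: "(nat ^ 'p) set \<Rightarrow> (nat ^ 'p) set \<Rightarrow> bool" where
  "I_semigroup S T \<longleftrightarrow>
     affine_semigroup T \<and> ideal_of S (T - {0}) \<and> C_semigroup (rat_cone S) T"

text \<open>The difference \<open>f - x\<close> is taken in the integers, so \<open>f - x \<in> S\<close> means \<open>f = x + s\<close>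
  for some \<open>s \<in> S\<close>; the truncated subtraction on \<open>nat\<close> would be wrong.\<close>

definition A_set ::
  "(nat ^ 'p \<Rightarrow> nat ^ 'p \<Rightarrow> bool) \<Rightarrow> (nat ^ 'p) set \<Rightarrow> nat ^ 'p \<Rightarrow> (nat ^ 'p) set" where
  "A_set le S f = {x \<in> S. strict le x f \<and> \<not> (\<exists>s\<in>S. f = x + s)}"

end

theory Submission imports Defs begin

text \<open>For (2) \<open>\<Longrightarrow>\<close> (1), the two points not read off directly from the description of \<open>T\<close> are
  that \<open>T\<close> spans the same cone as \<open>S\<close> and that \<open>T\<close> is finitely generated. The first holds because
  the multiples of a nonzero \<open>s \<in> S\<close> cannot all lie in the finite set of gaps of \<open>T\<close>. For the second,
  build \<open>t \<in> T\<close> by adding generators of \<open>S\<close> one by one: the first nonzero partial sum that lies in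
  \<open>T\<close> is a generator of \<open>S\<close> plus an element of the finite set \<open>F = (S - T) \<union> {0}\<close>, and what remains
  of \<open>t\<close> is an element of \<open>F\<close> or a smaller element of \<open>T\<close>.\<close>

lemma add_submonoid_hull: "add_submonoid (add_submonoid hull A)"
  by (rule hull_in) (auto simp: add_submonoid_def)

text \<open>Points satisfying \<open>P\<close> need not be closed under addition, but those whose
  translation preserves \<open>P\<close> form a submonoid, and it contains \<open>A\<close>.\<close>

lemma hull_add_induct [consumes 1, case_names zero add]:
  assumes "x \<in> add_submonoid hull A"
    and "P 0" and step: "\<And>s a. P s \<Longrightarrow> a \<in> A \<Longrightarrow> P (a + s)"
  shows "P x"
proof -
  have "\<forall>y. P y \<longrightarrow> P (x + y)"
    using assms(1)
  proof (rule hull_induct)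
    show "add_submonoid {x. \<forall>y. P y \<longrightarrow> P (x + y)}"
      by (auto simp: add_submonoid_def add.assoc)
  qed (use step in auto)
  with \<open>P 0\<close> show ?thesis by (metis add.right_neutral)
qed

lemma subset_rat_cone: "S \<subseteq> rat_cone S"
proof
  fix x assume "x \<in> S"
  then have "(\<forall>i<1. 0 \<le> (1::rat) \<and> x \<in> S) \<and>
      (\<forall>j. rat_of_nat (x $ j) = (\<Sum>i<(1::nat). 1 * rat_of_nat (x $ j)))" by simp
  then show "x \<in> rat_cone S"
    unfolding rat_cone_def mem_Collect_eq
    by (intro exI[of _ "1::nat"] exI[of _ "\<lambda>_. 1::rat"] exI[of _ "\<lambda>_. x"])
qed

lemma rat_cone_mono: "S \<subseteq> T \<Longrightarrow> rat_cone S \<subseteq> rat_cone T"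
  unfolding rat_cone_def by blast

lemma multiple_in_rat_cone:
  assumes "x \<in> S"
  shows "(\<chi> j. n * x $ j) \<in> rat_cone S"
proof -
  have "(\<forall>i<1. 0 \<le> rat_of_nat n \<and> x \<in> S) \<and>
      (\<forall>j. rat_of_nat ((\<chi> j. n * x $ j) $ j) = (\<Sum>i<(1::nat). rat_of_nat n * rat_of_nat (x $ j)))"
    using assms by simp
  then show ?thesis
    unfolding rat_cone_def mem_Collect_eq
    by (intro exI[of _ "1::nat"] exI[of _ "\<lambda>_. rat_of_nat n"] exI[of _ "\<lambda>_. x"])
qed

lemma ex_multiple_mem_cofinite:
  fixes S T :: "(nat ^ 'p) set"
  assumes fin: "finite (rat_cone S - T)" and "0 \<in> T" and "s \<in> S"
  shows "\<exists>n>0. (\<chi> j. n * s $ j) \<in> T"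
proof (cases "s = 0")
  case True
  then have "(\<chi> j. 1 * s $ j) \<in> T" using \<open>0 \<in> T\<close> by (simp add: vec_eq_iff zero_vec_def)
  then show ?thesis by blast
next
  case False
  then obtain j where j: "s $ j \<noteq> 0" by (auto simp: vec_eq_iff)
  \<comment> \<open>A nonzero coordinate keeps the positive multiples of \<open>s\<close> distinct,
    so infinitely many points of the cone arise and some of them avoid the gaps.\<close>
  have inj: "inj_on (\<lambda>n. \<chi> j. n * s $ j) {0<..}"
    using j by (auto simp: inj_on_def vec_eq_iff)
  have "\<not> (\<lambda>n. \<chi> j. n * s $ j) ` {0<..} \<subseteq> rat_cone S - T"
    using finite_subset[OF _ fin] finite_imageD[OF _ inj] infinite_Ioi by blast
  then show ?thesis using multiple_in_rat_cone[OF \<open>s \<in> S\<close>] by auto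
qed

lemma rat_cone_eq_of_cofinite:
  fixes S T :: "(nat ^ 'p) set"
  assumes "finite (rat_cone S - T)" and "0 \<in> T" and "T \<subseteq> S"
  shows "rat_cone T = rat_cone S"
proof
  show "rat_cone T \<subseteq> rat_cone S" using \<open>T \<subseteq> S\<close> by (rule rat_cone_mono)
  obtain n where n: "\<And>s. s \<in> S \<Longrightarrow> n s > 0 \<and> (\<chi> j. n s * s $ j) \<in> T"
    using ex_multiple_mem_cofinite[OF assms(1,2)] by metis
  show "rat_cone S \<subseteq> rat_cone T"
  proof
    fix x assume "x \<in> rat_cone S"
    then obtain k :: nat and l and b :: "nat \<Rightarrow> nat ^ 'p"
      where lb: "\<forall>i<k. 0 \<le> l i \<and> b i \<in> S"
        and x: "\<forall>j. rat_of_nat (x $ j) = (\<Sum>i<k. l i * rat_of_nat (b i $ j))"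
      unfolding rat_cone_def by blast
    \<comment> \<open>Each \<open>b i\<close> is scaled by its factor \<open>n (b i)\<close> to land
      in \<open>T\<close>, and its coefficient is divided by that factor, so every summand keeps its
      value.\<close>
    define l' where "l' i = l i / rat_of_nat (n (b i))" for i
    define b' where "b' i = (\<chi> j. n (b i) * b i $ j)" for i
    have n0: "n (b i) \<noteq> 0" if "i < k" for i using lb n that by blast
    have "\<forall>i<k. 0 \<le> l' i \<and> b' i \<in> T" using lb n by (simp add: l'_def b'_def)
    moreover have "\<forall>j. rat_of_nat (x $ j) = (\<Sum>i<k. l' i * rat_of_nat (b' i $ j))"
      unfolding x[rule_format]
      by (intro allI sum.cong refl) (auto simp: l'_def b'_def dest: n0)
    ultimately show "x \<in> rat_cone T" unfolding rat_cone_def by blast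
  qed
qed

lemma affine_semigroup_of_cofinite_ideal:
  fixes S T :: "(nat ^ 'p) set"
  assumes "affine_semigroup S" and "0 \<in> T" and ideal: "ideal_of S (T - {0})"
    and "finite (S - T)"
  shows "affine_semigroup T"
proof -
  obtain A where A: "finite A" "S = add_submonoid hull A"
    using assms(1) unfolding affine_semigroup_def by blast
  have S: "add_submonoid S" using A add_submonoid_hull by blast
  then have S0: "0 \<in> S" and Sadd: "\<And>x y. x \<in> S \<Longrightarrow> y \<in> S \<Longrightarrow> x + y \<in> S"
    by (auto simp: add_submonoid_def)
  have AS: "A \<subseteq> S" using A by (simp add: hull_subset)
  have TS: "T \<subseteq> S" using ideal S0 by (auto simp: ideal_of_def)
  have T: "add_submonoid T"
    unfolding add_submonoid_def
  proof (intro conjI ballI)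
    fix x y assume "x \<in> T" "y \<in> T"
    then show "x + y \<in> T" using ideal TS by (cases "x = 0") (auto simp: ideal_of_def)
  qed fact
  \<comment> \<open>\<open>F\<close> collects the sums that have not yet entered
    \<open>T - {0}\<close>. Containing \<open>0\<close>, it also allows an empty partial sum before
    a generator and an empty remainder after it.\<close>
  define F where "F = insert 0 (S - T)"
  \<comment> \<open>\<open>U\<close> holds the candidates for a first entry into
    \<open>T - {0}\<close>; \<open>G\<close> adds to them the remainders that cannot be split
    further.\<close>
  define U where "U = (\<lambda>(a, h). a + h) ` (A \<times> F) \<inter> (T - {0})"
  define G where "G = (\<lambda>(u, h). u + h) ` (U \<times> F)"
  have "finite F" using \<open>finite (S - T)\<close> by (simp add: F_def)
  then have "finite G" using A by (simp add: G_def U_def)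
  have FS: "F \<subseteq> S" using S0 by (auto simp: F_def)
  have "G \<subseteq> T" using ideal FS by (auto simp: G_def U_def ideal_of_def)
  have UG: "U \<subseteq> G" by (force simp: G_def F_def)
  \<comment> \<open>Induction over added generators: from \<open>s\<close> in \<open>F\<close>,
    adding \<open>a\<close> either stays in \<open>F\<close> or enters \<open>T - {0}\<close> with
    remainder \<open>0\<close>; once an element of \<open>U\<close> is split off, \<open>a\<close>
    joins the remainder.\<close>
  have split: "s \<in> F \<or> (\<exists>u\<in>U. \<exists>s'\<in>S. s = u + s')" if "s \<in> S" for s
    using that unfolding A(2)
  proof (induction rule: hull_add_induct)
    case zero
    show ?case by (simp add: F_def)
  next
    case (add s a)
    show ?case
    proof (cases "s \<in> F")
      case True
      then have "a + s \<in> S" using AS FS Sadd add.hyps by blast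
      then consider "a + s \<in> F" | "a + s \<in> T - {0}" by (auto simp: F_def)
      then show ?thesis
      proof cases
        case 2
        with True add.hyps have "a + s \<in> U" by (force simp: U_def)
        then show ?thesis using S0 A(2) by (metis add.right_neutral)
      qed simp
    next
      case False
      then obtain u s' where "u \<in> U" "s' \<in> S" "s = u + s'" using add.IH A(2) by blast
      then have "a + s = u + (a + s')" "a + s' \<in> S"
        using Sadd AS add.hyps by (auto simp: ac_simps)
      then show ?thesis using \<open>u \<in> U\<close> A(2) by blast
    qed
  qed
  have "t \<in> add_submonoid hull G" if "t \<in> T" for t
    using that
  \<comment> \<open>The coordinate sum decreases when a nonzero \<open>u\<close> is split off
    \<open>t\<close>.\<close>
  proof (induction "\<Sum>j\<in>UNIV. t $ j" arbitrary: t rule: less_induct)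
    case less
    have H: "add_submonoid (add_submonoid hull G)" by (rule add_submonoid_hull)
    show ?case
    proof (cases "t = 0")
      case True
      then show ?thesis using H by (simp add: add_submonoid_def)
    next
      case False
      then have "t \<notin> F" using less.prems by (simp add: F_def)
      then obtain u s where us: "u \<in> U" "s \<in> S" "t = u + s" using split less.prems TS by blast
      show ?thesis
      proof (cases "s \<in> F")
        case True
        then have "t \<in> G" using us by (force simp: G_def)
        then show ?thesis by (rule hull_inc)
      next
        case False
        then have "s \<in> T" using us by (auto simp: F_def)
        have "u \<noteq> 0" using us by (simp add: U_def)
        then obtain j where "u $ j > 0" by (auto simp: vec_eq_iff)
        then have "(\<Sum>j\<in>UNIV. u $ j) > 0" by (meson UNIV_I finite_UNIV finite sum_pos2 le0)
        then have "s \<in> add_submonoid hull G"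
          using us \<open>s \<in> T\<close> by (intro less.hyps) (simp_all add: sum.distrib)
        moreover have "u \<in> add_submonoid hull G" using us UG by (meson hull_inc subsetD)
        ultimately show ?thesis using H us by (simp add: add_submonoid_def)
      qed
    qed
  qed
  then have "T = add_submonoid hull G"
    using hull_minimal[of G T add_submonoid] \<open>G \<subseteq> T\<close> T by blast
  with \<open>finite G\<close> show ?thesis unfolding affine_semigroup_def by blast
qed

text \<open>The finiteness hypothesis is the standing assumption on gaps. Under a lexicographic
  order infinitely many points may lie below \<open>f\<close>, so the shape of \<open>T\<close> in
  (2) alone does not supply it.\<close>

theorem proposition14:
  fixes S T :: "(nat ^ 'p) set"
    and le :: "nat ^ 'p \<Rightarrow> nat ^ 'p \<Rightarrow> bool"
    and f g :: "nat ^ 'p"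
  assumes "C_semigroup (rat_cone S) S"
    and "monomial_order le"
    and "is_Frobenius le S g"
    and "f \<in> rat_cone S"
    and "le g f"
    and "finite (rat_cone S - T)"
  shows "(I_semigroup S T \<and> is_Frobenius le T f) \<longleftrightarrow>
    (\<exists>X. X \<subseteq> A_set le S f \<and>
         (\<forall>x\<in>X. \<forall>s\<in>S. strict le (x + s) f \<longrightarrow> x + s \<in> X) \<and>
         X \<inter> {x \<in> rat_cone S. strict le f x} = {} \<and>
         T = X \<union> {x \<in> rat_cone S. strict le f x} \<union> {0})"
proof -
  let ?C = "rat_cone S" and ?lt = "strict le"
  have aff: "affine_semigroup S" using assms(1) by (simp add: C_semigroup_def)
  then have "add_submonoid S" unfolding affine_semigroup_def using add_submonoid_hull by blast
  then have S0: "0 \<in> S" and Sadd: "\<And>x y. x \<in> S \<Longrightarrow> y \<in> S \<Longrightarrow> x + y \<in> S"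
    by (auto simp: add_submonoid_def)
  have SC: "S \<subseteq> ?C" by (rule subset_rat_cone)
  have trans: "le x y \<Longrightarrow> le y z \<Longrightarrow> le x z"
    and antisym: "le x y \<Longrightarrow> le y x \<Longrightarrow> x = y"
    and total: "le x y \<or> le y x"
    and mono: "le x y \<Longrightarrow> le (x + z) (y + z)"
    and zero_le: "le 0 x" for x y z
    using assms(2) unfolding monomial_order_def reflp_def totalp_on_def
    by (meson transpD, meson antisympD, metis UNIV_I, blast, blast)
  have le_add: "le x (x + s)" for x s
    using mono[OF zero_le[of s], of x] by (simp add: add.commute)
  have trichotomy: "x = y \<or> ?lt x y \<or> ?lt y x" for x y
    using total by (auto simp: strict_def)
  have gap_le: "le x g" if "x \<in> ?C" "x \<notin> S" for x
    using assms(3) that by (simp add: is_Frobenius_def)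
  \<comment> \<open>That \<open>f\<close> is nonzero ensures that the summand \<open>{0}\<close>
    does not put \<open>f\<close> into \<open>T\<close>.\<close>
  have "g \<noteq> 0" using assms(3) S0 by (auto simp: is_Frobenius_def)
  then have "f \<noteq> 0" using assms(5) antisym zero_le by blast
  show ?thesis
  proof
    assume "I_semigroup S T \<and> is_Frobenius le T f"
    then have ideal: "ideal_of S (T - {0})" and "affine_semigroup T" and cone: "?C = rat_cone T"
      and "f \<notin> T" and Fb: "\<And>x. x \<in> rat_cone T - T \<Longrightarrow> le x f"
      by (auto simp: I_semigroup_def is_Frobenius_def C_semigroup_def)
    have "0 \<in> T"
      using \<open>affine_semigroup T\<close> add_submonoid_hull
      by (auto simp: affine_semigroup_def add_submonoid_def)
    have TC: "T \<subseteq> ?C" using cone subset_rat_cone by metis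
    have upper: "x \<in> T" if "x \<in> ?C" "?lt f x" for x
      using Fb that antisym cone by (auto simp: strict_def)
    \<comment> \<open>\<open>0\<close> is left out because it is not in \<open>A_set le S f\<close>
      when \<open>f \<in> S\<close>. For the other points, \<open>f = x + s\<close> would put
      \<open>f\<close> into the ideal \<open>T - {0}\<close>.\<close>
    define X where "X = {x \<in> T - {0}. ?lt x f}"
    have "X \<subseteq> A_set le S f"
      using ideal \<open>f \<notin> T\<close> by (auto simp: X_def A_set_def ideal_of_def)
    moreover have "\<forall>x\<in>X. \<forall>s\<in>S. ?lt (x + s) f \<longrightarrow> x + s \<in> X"
      using ideal by (auto simp: X_def ideal_of_def)
    moreover have "X \<inter> {x \<in> ?C. ?lt f x} = {}"
      using antisym by (auto simp: X_def strict_def)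
    moreover have "T = X \<union> {x \<in> ?C. ?lt f x} \<union> {0}"
    proof (rule equalityI)
      show "T \<subseteq> X \<union> {x \<in> ?C. ?lt f x} \<union> {0}"
      proof
        fix x assume "x \<in> T"
        then show "x \<in> X \<union> {x \<in> ?C. ?lt f x} \<union> {0}"
          using TC \<open>f \<notin> T\<close> trichotomy[of x f] by (auto simp: X_def)
      qed
    qed (use upper \<open>0 \<in> T\<close> in \<open>auto simp: X_def\<close>)
    ultimately show "\<exists>X. X \<subseteq> A_set le S f \<and>
         (\<forall>x\<in>X. \<forall>s\<in>S. ?lt (x + s) f \<longrightarrow> x + s \<in> X) \<and>
         X \<inter> {x \<in> ?C. ?lt f x} = {} \<and>
         T = X \<union> {x \<in> ?C. ?lt f x} \<union> {0}"
      by (intro exI[of _ X] conjI)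
  next
    assume "\<exists>X. X \<subseteq> A_set le S f \<and>
         (\<forall>x\<in>X. \<forall>s\<in>S. ?lt (x + s) f \<longrightarrow> x + s \<in> X) \<and>
         X \<inter> {x \<in> ?C. ?lt f x} = {} \<and>
         T = X \<union> {x \<in> ?C. ?lt f x} \<union> {0}"
    then obtain X where XA: "X \<subseteq> A_set le S f"
      and Xadd: "\<And>x s. x \<in> X \<Longrightarrow> s \<in> S \<Longrightarrow> ?lt (x + s) f \<Longrightarrow> x + s \<in> X"
      and T: "T = X \<union> {x \<in> ?C. ?lt f x} \<union> {0}"
      by blast
    \<comment> \<open>Gaps of \<open>S\<close> are at most \<open>g\<close>, hence at most
      \<open>f\<close>.\<close>
    have upper: "x \<in> S" if "x \<in> ?C" "?lt f x" for x
      using gap_le[OF that(1)] trans[OF _ assms(5)] antisym that(2) by (auto simp: strict_def)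
    have TS: "T \<subseteq> S" using T XA upper S0 by (auto simp: A_set_def)
    have "0 \<in> T" using T by simp
    have "f \<notin> T" using T XA \<open>f \<noteq> 0\<close> by (auto simp: A_set_def strict_def)
    have ideal: "ideal_of S (T - {0})"
      unfolding ideal_of_def
    proof (intro conjI ballI)
      fix x s assume x: "x \<in> T - {0}" and s: "s \<in> S"
      have C: "x + s \<in> ?C" using x s TS Sadd SC by blast
      \<comment> \<open>Natural coordinates cannot cancel.\<close>
      have "x + s \<noteq> 0" using x by (auto simp: vec_eq_iff)
      moreover have "x + s \<in> T"
      proof (cases "x \<in> X")
        case True
        \<comment> \<open>This is the condition \<open>f - x \<notin> S\<close> of
          \<open>A_set\<close>. Below \<open>f\<close> the closure of \<open>X\<close> applies, and
          above \<open>f\<close> every point of the cone is in \<open>T\<close>.\<close>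
        then have "x + s \<noteq> f" using XA s by (auto simp: A_set_def)
        then show ?thesis using trichotomy[of "x + s" f] Xadd[OF True s] C T by blast
      next
        case False
        then have "?lt f x" using x T by blast
        then have "?lt f (x + s)" using le_add[of x s] trans[of f x "x + s"] antisym[of f x]
          by (auto simp: strict_def)
        then show ?thesis using C T by blast
      qed
      ultimately show "x + s \<in> T - {0}" by simp
    qed (use TS in auto)
    \<comment> \<open>\<open>is_Frobenius le T f\<close> measures gaps in the cone of
      \<open>T\<close>, which must therefore be identified with that of \<open>S\<close>.\<close>
    have cone: "rat_cone T = ?C" using assms(6) \<open>0 \<in> T\<close> TS by (rule rat_cone_eq_of_cofinite)
    have "finite (S - T)" using assms(6) SC by (meson Diff_mono finite_subset order_refl)
    with aff \<open>0 \<in> T\<close> ideal have "affine_semigroup T" by (rule affine_semigroup_of_cofinite_ideal)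
    then have "I_semigroup S T"
      using ideal cone assms(6) by (simp add: I_semigroup_def C_semigroup_def)
    moreover have "is_Frobenius le T f"
      unfolding is_Frobenius_def cone
      using assms(4) \<open>f \<notin> T\<close> T total by (auto simp: strict_def)
    ultimately show "I_semigroup S T \<and> is_Frobenius le T f" by simp
  qed
qed

end
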